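(* Let $\mathbb{M}$ be a mesh with cells $C_1,\dots,C_N$, let $\bar\sigma>0$ be a strictly positive weight function, let $\Omega^{\bar\sigma}$ be the diagonal matrix of weighted cell volumes, and let $\ell_d=\ell_d(A,\Theta):\mathfrak{d}_{\bar\sigma}(\mathbb{M})\times\mathbb{R}^N\to\mathbb{R}$ be a (smooth) discrete Lagrangian. A curve $(A(t),\Theta(t))\in\mathfrak{d}_{\bar\sigma}(\mathbb{M})\times\mathbb{R}^N$, $t\in[0,T]$, with $A(t)\in\mathcal{S}_{\bar\sigma}$, is critical for the variational principle $$\delta\int_0^T\ell_d(A,\Theta)\,dt=0\quad\text{for variations}\quad\delta A=\partial_tY+[Y,A],\quad\delta\Theta=Y\Theta,$$ where $Y(t)$ is an arbitrary time-dependent matrix in $\mathcal{S}_{\bar\sigma}$ vanishing at $t=0,T$, if and only if there exists a (time-dependent) discrete function $P\in\mathbb{R}^N$ such that $$\frac{d}{dt}\frac{\delta\ell_d}{\delta A_{ij}}+\left(\left[\frac{\delta\ell_d}{\delta A}\Omega^{\bar\sigma},A\right](\Omega^{\bar\sigma})^{-1}\right)_{ij}-\frac12\left(\frac{\delta\ell_d}{\delta\Theta_i}+\frac{\delta\ell_d}{\delta\Theta_j}\right)(\Theta_j-\Theta_i)+(P_i-P_j)=0$$ for all $i$ and all $j\in N(i)$.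
   Context: $\mathbb{M}$ is a mesh on a fluid domain $\mathcal{D}$ with cells $C_1,\dots,C_N$; $N(i)$ is the set of indices of cells adjacent to $C_i$ (adjacency is a symmetric relation between distinct cells). $\Omega^{\bar\sigma}$ is the diagonal $N\times N$ matrix with positive entries $\Omega^{\bar\sigma}_i=\int_{C_i}\bar\sigma\,d\mathbf{x}$. With $\mathbf{1}=(1,\dots,1)^{\mathsf T}$, $$\mathfrak{d}_{\bar\sigma}(\mathbb{M})=\{A\in\mathfrak{gl}(N) : A\mathbf{1}=0,\ A^{\mathsf T}\Omega^{\bar\sigma}+\Omega^{\bar\sigma}A=0\},\qquad \mathcal{S}_{\bar\sigma}=\{A\in\mathfrak{d}_{\bar\sigma}(\mathbb{M}) : A_{ij}\neq0\Rightarrow j\in N(i)\}.$$ $[\cdot,\cdot]$ is the matrix commutator $[X,Y]=XY-YX$. Discrete one-forms $\Omega^1_d(\mathbb{M})$ are skew-symmetric $N\times N$ matrices; discrete functions $\Omega^0_d(\mathbb{M})=\mathbb{R}^N$; the discrete exterior derivative is $(\mathrm{d}F)_{ij}=F_i-F_j$. The pairings are $$\langle\!\langle K,A\rangle\!\rangle_{\bar\sigma}=\operatorname{Tr}(K^{\mathsf T}\Omega^{\bar\sigma}A),\ K\in\Omega^1_d(\mathbb{M}),A\in\mathfrak{d}_{\bar\sigma}(\mathbb{M});\qquad \langle F,G\rangle_{\bar\sigma}=F^{\mathsf T}\Omega^{\bar\sigma}G,\ F,G\in\mathbb{R}^N.$$ The first pairing identifies $\mathfrak{d}_{\bar\sigma}(\mathbb{M})^*\simeq\Omega^1_d(\mathbb{M})/\mathrm{d}\Omega^0_d(\mathbb{M})$.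 The functional derivatives $\frac{\delta\ell_d}{\delta A}\in\Omega^1_d(\mathbb{M})$ (a representative of its class modulo $\mathrm{d}\Omega^0_d(\mathbb{M})$, depending smoothly on time along the curve) and $\frac{\delta\ell_d}{\delta\Theta}\in\mathbb{R}^N$ are defined by $D\ell_d(A,\Theta)\cdot(\delta A,\delta\Theta)=\langle\!\langle\frac{\delta\ell_d}{\delta A},\delta A\rangle\!\rangle_{\bar\sigma}+\langle\frac{\delta\ell_d}{\delta\Theta},\delta\Theta\rangle_{\bar\sigma}$ for all $\delta A\in\mathfrak{d}_{\bar\sigma}(\mathbb{M})$, $\delta\Theta\in\mathbb{R}^N$; $\frac{\delta\ell_d}{\delta A_{ij}}$ denotes the $(i,j)$ entry of $\frac{\delta\ell_d}{\delta A}$. *)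

theory Defs
  imports "HOL-Analysis.Analysis"
begin

text \<open>
  Infinite Frechet differentiability relative to a set: \<open>D [v\<^sub>k, \<dots>, v\<^sub>1] x\<close> is the iterated derivative
  of \<open>f\<close> at \<open>x\<close> in the directions \<open>v\<^sub>1, \<dots>, v\<^sub>k\<close>. It is used only for a linear subspace, where only
  directions in the subspace matter, and for a compact interval, with one-sided derivatives at the
  end points. In both cases \<open>f\<close> is unconstrained outside of \<open>S\<close>.
\<close>

definition smooth_on :: "'a::real_normed_vector set \<Rightarrow> ('a \<Rightarrow> 'b::real_normed_vector) \<Rightarrow> bool"
  where "smooth_on S f \<longleftrightarrow>
    (\<exists>D :: 'a list \<Rightarrow> 'a \<Rightarrow> 'b.
       (\<forall>x\<in>S. D [] x = f x) \<and>
       (\<forall>vs. \<forall>x\<in>S. (D vs has_derivative (\<lambda>v. D (v # vs) x)) (at x within S)))"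

text \<open>
  The cells are indexed by the finite type \<open>'n\<close>, so the number of cells is \<open>CARD('n)\<close>. Which cells
  count as adjacent is part of the mesh: \<open>nbr i\<close> is the set of indices of the cells adjacent
  to \<open>C i\<close>, and adjacency is any symmetric relation between distinct cells.
\<close>

definition mesh :: "'a::euclidean_space set \<Rightarrow> ('n::finite \<Rightarrow> 'a set) \<Rightarrow> ('n \<Rightarrow> 'n set) \<Rightarrow> bool"
  where "mesh \<D> C nbr \<longleftrightarrow>
    (\<Union>i. C i) = \<D> \<and>
    (\<forall>i. C i \<in> lmeasurable \<and> measure lebesgue (C i) > 0) \<and>
    (\<forall>i j. i \<noteq> j \<longrightarrow> negligible (C i \<inter> C j)) \<and>
    (\<forall>i j. j \<in> nbr i \<longrightarrow> i \<in> nbr j) \<and>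
    (\<forall>i. i \<notin> nbr i)"

definition weight_on :: "'a::euclidean_space set \<Rightarrow> ('a \<Rightarrow> real) \<Rightarrow> bool"
  where "weight_on \<D> \<sigma> \<longleftrightarrow> set_integrable lebesgue \<D> \<sigma> \<and> (\<forall>x\<in>\<D>. \<sigma> x > 0)"

definition cell_volumes :: "('a::euclidean_space \<Rightarrow> real) \<Rightarrow> ('n::finite \<Rightarrow> 'a set) \<Rightarrow> real^'n^'n"
  where "cell_volumes \<sigma> C = (\<chi> i j. if i = j then (LINT x:C i|lebesgue. \<sigma> x) else 0)"

definition commutator :: "real^'n^'n \<Rightarrow> real^'n^'n \<Rightarrow> real^'n^'n::finite"
  where "commutator X Y = X ** Y - Y ** X"

text \<open>In the following, \<open>W\<close> is the diagonal matrix \<open>\<Omega>\<close> of weighted cell volumes.\<close>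

definition discrete_diffs :: "real^'n^'n \<Rightarrow> (real^'n^'n::finite) set"
  where "discrete_diffs W = {A. A *v 1 = 0 \<and> transpose A ** W + W ** A = 0}"

definition sparse_diffs :: "real^'n^'n \<Rightarrow> ('n \<Rightarrow> 'n set) \<Rightarrow> (real^'n^'n::finite) set"
  where "sparse_diffs W nbr =
    {A \<in> discrete_diffs W. \<forall>i j. A $ i $ j \<noteq> 0 \<longrightarrow> j \<in> nbr i}"

definition one_forms :: "(real^'n^'n::finite) set"
  where "one_forms = {K. transpose K = - K}"

definition discrete_d :: "real^'n \<Rightarrow> real^'n^'n::finite"
  where "discrete_d F = (\<chi> i j. F $ i - F $ j)"

definition pairing_form :: "real^'n^'n \<Rightarrow> real^'n^'n \<Rightarrow> real^'n^'n::finite \<Rightarrow> real"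
  where "pairing_form W K A = trace (transpose K ** W ** A)"

definition pairing_fun :: "real^'n^'n \<Rightarrow> real^'n \<Rightarrow> real^'n::finite \<Rightarrow> real"
  where "pairing_fun W F G = F \<bullet> (W *v G)"

text \<open>
  \<open>K\<close> is a representative of \<open>\<delta>L/\<delta>A\<close>, which is determined only modulo the range
  of \<^const>\<open>discrete_d\<close>, and \<open>g\<close> is \<open>\<delta>L/\<delta>\<Theta>\<close>.
\<close>

definition functional_derivatives ::
    "real^'n^'n \<Rightarrow> ((real^'n^'n) \<times> (real^'n) \<Rightarrow> real) \<Rightarrow> real^'n^'n \<Rightarrow> real^'n
       \<Rightarrow> real^'n^'n \<Rightarrow> real^'n::finite \<Rightarrow> bool"
  where "functional_derivatives W L A \<Theta> K g \<longleftrightarrow>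
    K \<in> one_forms \<and>
    (\<exists>DL. (L has_derivative DL) (at (A, \<Theta>) within discrete_diffs W \<times> UNIV) \<and>
       (\<forall>\<delta>A\<in>discrete_diffs W. \<forall>\<delta>\<Theta>.
          DL (\<delta>A, \<delta>\<Theta>) = pairing_form W K \<delta>A + pairing_fun W g \<delta>\<Theta>))"

definition action ::
    "((real^'n^'n) \<times> (real^'n) \<Rightarrow> real) \<Rightarrow> real \<Rightarrow> (real \<Rightarrow> real^'n^'n) \<Rightarrow> (real \<Rightarrow> real^'n::finite) \<Rightarrow> real"
  where "action L T A \<Theta> = integral {0..T} (\<lambda>t. L (A t, \<Theta> t))"

text \<open>
  The first variation of the action along \<open>(\<delta>A, \<delta>\<Theta>)\<close> is its derivative at \<open>\<epsilon> = 0\<close> along the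
  family \<open>(A + \<epsilon> \<delta>A, \<Theta> + \<epsilon> \<delta>\<Theta>)\<close>. This family stays in the linear space on which the Lagrangian
  is defined, because \<open>\<partial>\<^sub>t Y + [Y, A]\<close> lies in \<^term>\<open>discrete_diffs W\<close> (though in general not in
  \<^term>\<open>sparse_diffs W nbr\<close>) whenever \<open>Y\<close> and \<open>A\<close> do.
\<close>

definition has_first_variation ::
    "((real^'n^'n) \<times> (real^'n) \<Rightarrow> real) \<Rightarrow> real \<Rightarrow> (real \<Rightarrow> real^'n^'n) \<Rightarrow> (real \<Rightarrow> real^'n)
       \<Rightarrow> (real \<Rightarrow> real^'n^'n) \<Rightarrow> (real \<Rightarrow> real^'n::finite) \<Rightarrow> real \<Rightarrow> bool"
  where "has_first_variation L T A \<Theta> \<delta>A \<delta>\<Theta> v \<longleftrightarrow>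
    ((\<lambda>\<epsilon>. action L T (\<lambda>t. A t + \<epsilon> *\<^sub>R \<delta>A t) (\<lambda>t. \<Theta> t + \<epsilon> *\<^sub>R \<delta>\<Theta> t))
       has_real_derivative v) (at 0)"

definition critical ::
    "real^'n^'n \<Rightarrow> ('n \<Rightarrow> 'n set) \<Rightarrow> ((real^'n^'n) \<times> (real^'n) \<Rightarrow> real) \<Rightarrow> real
       \<Rightarrow> (real \<Rightarrow> real^'n^'n) \<Rightarrow> (real \<Rightarrow> real^'n::finite) \<Rightarrow> bool"
  where "critical W nbr L T A \<Theta> \<longleftrightarrow>
    (\<forall>Y. smooth_on {0..T} Y \<and> (\<forall>t\<in>{0..T}. Y t \<in> sparse_diffs W nbr) \<and> Y 0 = 0 \<and> Y T = 0 \<longrightarrow>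
       has_first_variation L T A \<Theta>
         (\<lambda>t. vector_derivative Y (at t within {0..T}) + commutator (Y t) (A t))
         (\<lambda>t. Y t *v \<Theta> t) 0)"

end

theory Submission
  imports Defs
begin

text \<open>
  Differentiating the action under the integral sign and integrating by parts turns the first
  variation along \<open>Y\<close> into \<open>- \<integral> E \<bullet> (\<Omega> Y) dt\<close>, where \<open>E\<close> is the left-hand side of the equation
  without the term \<open>P\<^sub>i - P\<^sub>j\<close>. The matrices \<open>\<Omega> Y\<close> with \<open>Y\<close> in \<open>sparse_diffs \<Omega> nbr\<close> are exactly the
  circulations of the mesh: skew, supported on the edges, with vanishing row sums. By the fundamental
  lemma, with polynomial test functions, criticality says that the skew matrix \<open>E t\<close> is orthogonal to
  all circulations at every time. On the edges, the orthogonal complement of the circulations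
  consists of the discrete gradients, which gives \<open>P t\<close>; no regularity of \<open>P\<close> is required.
\<close>

subsection \<open>Matrices\<close>

lemma bounded_bilinear_matrix_matrix_mult:
  "bounded_bilinear ((**) :: real^'n^'m \<Rightarrow> real^'k^'n \<Rightarrow> real^'k^'m)"
  by (auto simp: bilinear_conv_bounded_bilinear[symmetric] bilinear_def linear_iff
      matrix_add_ldistrib matrix_scalar_ac scalar_matrix_assoc
      matrix_matrix_mult_def vec_eq_iff sum.distrib sum_distrib_left algebra_simps)

lemma bounded_bilinear_matrix_vector_mult:
  "bounded_bilinear ((*v) :: real^'n^'m \<Rightarrow> real^'n \<Rightarrow> real^'m)"
  by (auto simp: bilinear_conv_bounded_bilinear[symmetric] bilinear_def linear_iff
      matrix_vector_mult_def vec_eq_iff sum.distrib sum_distrib_left algebra_simps)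

interpretation matrix_mult: bounded_bilinear "(**) :: real^'n^'m \<Rightarrow> real^'k^'n \<Rightarrow> real^'k^'m"
  by (rule bounded_bilinear_matrix_matrix_mult)

interpretation matrix_vector: bounded_bilinear "(*v) :: real^'n^'m \<Rightarrow> real^'n \<Rightarrow> real^'m"
  by (rule bounded_bilinear_matrix_vector_mult)

lemma transpose_diff: "transpose (X - Z) = transpose X - transpose (Z :: real^'n^'m)"
  and transpose_minus: "transpose (- X) = - transpose (X :: real^'n^'m)"
  and transpose_add: "transpose (X + Z) = transpose X + transpose (Z :: real^'n^'m)"
  and transpose_zero: "transpose (0 :: real^'n^'m) = 0"
  by (simp_all add: transpose_def vec_eq_iff)

lemma inner_matrix_eq_sum: "(X :: real^'n^'m) \<bullet> Z = (\<Sum>i\<in>UNIV. \<Sum>j\<in>UNIV. X $ i $ j * Z $ i $ j)"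
  by (simp add: inner_vec_def)

lemma inner_matrix_eq_trace: "(X :: real^'n^'m) \<bullet> Z = trace (transpose X ** Z)"
  unfolding inner_matrix_eq_sum trace_def matrix_matrix_mult_def transpose_def
  by simp (rule sum.swap)

subsection \<open>Curves and directional derivatives\<close>

text \<open>By homogeneity in the direction, the witness \<open>D [1]\<close> is the velocity of the
  curve. It is continuous because it is again differentiable, with derivative given by the lists one
  element longer.\<close>

lemma smooth_on_has_vector_derivative:
  fixes f :: "real \<Rightarrow> 'a::euclidean_space"
  assumes "smooth_on {0..T} f" "T > 0"
  defines "f' \<equiv> \<lambda>t. vector_derivative f (at t within {0..T})"
  shows "\<And>t. t \<in> {0..T} \<Longrightarrow> (f has_vector_derivative f' t) (at t within {0..T})"
    and "continuous_on {0..T} f'"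
proof -
  obtain D where D0: "\<And>t. t \<in> {0..T} \<Longrightarrow> D [] t = f t"
    and D: "\<And>vs t. t \<in> {0..T} \<Longrightarrow> (D vs has_derivative (\<lambda>v. D (v # vs) t)) (at t within {0..T})"
    using assms(1) unfolding smooth_on_def by metis
  have der: "(f has_vector_derivative D [1] t) (at t within {0..T})" if t: "t \<in> {0..T}" for t
  proof -
    have lin: "D [v] t = v *\<^sub>R D [1] t" for v
      using linear_scale[OF has_derivative_linear[OF D[OF t, of "[]"]], of v 1] by simp
    have "(f has_derivative (\<lambda>v. D [v] t)) (at t within {0..T})"
      by (rule has_derivative_transform[OF t _ D[OF t]]) (simp add: D0)
    then show ?thesis
      unfolding has_vector_derivative_def by (subst (asm) lin)
  qed
  have f': "f' t = D [1] t" if "t \<in> {0..T}" for t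
    unfolding f'_def using der[OF that] that assms(2) by (intro vector_derivative_within_closed_interval)
  show "(f has_vector_derivative f' t) (at t within {0..T})" if "t \<in> {0..T}" for t
    using der f' that by simp
  have "continuous_on {0..T} (D [1])"
    by (rule has_derivative_continuous_on[OF D])
  then show "continuous_on {0..T} f'"
    by (rule continuous_on_eq) (simp add: f')
qed

lemma smooth_on_continuous_on:
  fixes f :: "'a::real_normed_vector \<Rightarrow> 'b::real_normed_vector"
  assumes "smooth_on S f"
  shows "continuous_on S f"
proof -
  obtain D where D0: "\<And>x. x \<in> S \<Longrightarrow> D [] x = f x"
    and D: "\<And>vs x. x \<in> S \<Longrightarrow> (D vs has_derivative (\<lambda>v. D (v # vs) x)) (at x within S)"
    using assms unfolding smooth_on_def by metis
  have "continuous_on S (D [])"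
    by (rule has_derivative_continuous_on[OF D])
  then show ?thesis
    by (rule continuous_on_eq) (simp add: D0)
qed

text \<open>Pairing the curve with a vector of the orthogonal complement gives the zero function, so
  the velocity pairs to zero too; in finite dimension the double complement is \<open>V\<close>
  again.\<close>

lemma has_vector_derivative_in_subspace:
  fixes f :: "real \<Rightarrow> 'a::euclidean_space"
  assumes V: "subspace V" and fV: "\<And>t. t \<in> {a..b} \<Longrightarrow> f t \<in> V"
    and f': "(f has_vector_derivative f') (at t within {a..b})" and t: "t \<in> {a..b}" "a < b"
  shows "f' \<in> V"
proof -
  have "f' \<bullet> y = 0" if y: "y \<in> V\<^sup>\<bottom>" for y
  proof -
    have "((\<lambda>s. f s \<bullet> y) has_vector_derivative f' \<bullet> y) (at t within {a..b})"
      by (rule bounded_linear.has_vector_derivative[OF bounded_linear_inner_left f'])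
    moreover have "((\<lambda>s. f s \<bullet> y) has_vector_derivative 0) (at t within {a..b})"
    proof (rule has_vector_derivative_transform[OF t(1)])
      show "((\<lambda>s. 0) has_vector_derivative (0::real)) (at t within {a..b})" by simp
      show "f s \<bullet> y = 0" if "s \<in> {a..b}" for s
        using y fV[OF that] by (auto simp: orthogonal_comp_def orthogonal_def)
    qed
    ultimately show ?thesis
      using vector_derivative_unique_within_closed_interval[of a b t] t by simp
  qed
  then have "f' \<in> V\<^sup>\<bottom>\<^sup>\<bottom>"
    by (auto simp: orthogonal_comp_def orthogonal_def inner_commute)
  then show ?thesis
    using orthogonal_comp_self[OF V] by simp
qed

text \<open>\<open>L\<close> is differentiable only relative to \<open>S\<close>, but the whole line
  stays in \<open>S\<close>, so the chain rule still yields a two-sided derivative in the real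
  parameter.\<close>

lemma has_derivative_along_line:
  assumes S: "subspace S" and "x \<in> S" "v \<in> S"
    and L: "(L has_derivative D) (at (x + c *\<^sub>R v) within S)"
  shows "((\<lambda>\<epsilon>. L (x + \<epsilon> *\<^sub>R v)) has_vector_derivative D v) (at c)"
proof -
  have img: "(\<lambda>\<epsilon>. x + \<epsilon> *\<^sub>R v) ` UNIV \<subseteq> S"
    using assms by (auto intro: subspace_add subspace_scale)
  have line: "((\<lambda>\<epsilon>. x + \<epsilon> *\<^sub>R v) has_derivative (\<lambda>\<epsilon>. \<epsilon> *\<^sub>R v)) (at c)"
    by (auto intro!: derivative_eq_intros)
  have "((\<lambda>\<epsilon>. L (x + \<epsilon> *\<^sub>R v)) has_derivative (\<lambda>\<epsilon>. D (\<epsilon> *\<^sub>R v))) (at c)"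
    using has_derivative_in_compose[OF line, of L D] has_derivative_subset[OF L img] by simp
  then show ?thesis
    using linear_scale[OF has_derivative_linear[OF L]] by (simp add: has_vector_derivative_def)
qed

text \<open>A derivative relative to a proper subspace is not unique as a linear map, but its values
  on directions of the subspace are. This lets the derivative supplied by smoothness be compared
  with the one inside \<open>functional_derivatives\<close>.\<close>

lemma has_derivative_subspace_unique:
  assumes "subspace S" "x \<in> S" "v \<in> S"
    and "(L has_derivative D) (at x within S)" "(L has_derivative D') (at x within S)"
  shows "D v = D' v"
  using has_derivative_along_line[OF assms(1-3), of L D 0]
    has_derivative_along_line[OF assms(1-3), of L D' 0] assms(4,5)
  by (auto intro: vector_derivative_unique_at)

lemma smooth_on_imp_derivative:
  assumes "smooth_on S L"
  obtains D where "\<And>x. x \<in> S \<Longrightarrow> (L has_derivative D x) (at x within S)"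
    and "\<And>v. continuous_on S (\<lambda>x. D x v)"
proof -
  obtain D where D0: "\<And>x. x \<in> S \<Longrightarrow> D [] x = L x"
    and D: "\<And>vs x. x \<in> S \<Longrightarrow> (D vs has_derivative (\<lambda>v. D (v # vs) x)) (at x within S)"
    using assms unfolding smooth_on_def by metis
  show thesis
  proof
    show "(L has_derivative (\<lambda>v. D [v] x)) (at x within S)" if "x \<in> S" for x
      by (rule has_derivative_transform[OF that _ D[OF that]]) (simp add: D0)
    show "continuous_on S (\<lambda>x. D [v] x)" for v
      by (rule has_derivative_continuous_on[OF D])
  qed
qed

text \<open>Smoothness gives continuity of the derivative for each fixed direction only. Expanding a
  moving direction in a finite basis reduces to that case.\<close>

lemma continuous_on_derivative_apply:
  fixes D :: "'a::euclidean_space \<Rightarrow> 'a \<Rightarrow> real"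
  assumes lin: "\<And>x. x \<in> S \<Longrightarrow> linear (D x)" and D: "\<And>v. continuous_on S (\<lambda>x. D x v)"
    and x: "continuous_on X x" "x ` X \<subseteq> S" and v: "continuous_on X v"
  shows "continuous_on X (\<lambda>t. D (x t) (v t))"
proof -
  have "continuous_on X (\<lambda>t. \<Sum>b\<in>Basis. (v t \<bullet> b) * D (x t) b)"
    using x v by (intro continuous_intros continuous_on_compose2[OF D]) auto
  moreover have "D (x t) (v t) = (\<Sum>b\<in>Basis. (v t \<bullet> b) * D (x t) b)" if "t \<in> X" for t
  proof -
    interpret linear "D (x t)" using lin x that by auto
    have "D (x t) (v t) = D (x t) (\<Sum>b\<in>Basis. (v t \<bullet> b) *\<^sub>R b)"
      by (simp add: euclidean_representation)
    then show ?thesis by (simp add: sum scale)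
  qed
  ultimately show ?thesis by (auto intro: continuous_on_eq)
qed

text \<open>Leibniz' rule applies because the derivative of the integrand is jointly continuous in
  the parameter and in time.\<close>

lemma first_variation_integral:
  fixes L :: "'a::euclidean_space \<Rightarrow> real" and T :: real
  assumes S: "subspace S" and L: "\<And>x. x \<in> S \<Longrightarrow> (L has_derivative D x) (at x within S)"
    and D: "\<And>v. continuous_on S (\<lambda>x. D x v)"
    and x: "continuous_on {0..T} x" "\<And>t. t \<in> {0..T} \<Longrightarrow> x t \<in> S"
    and v: "continuous_on {0..T} v" "\<And>t. t \<in> {0..T} \<Longrightarrow> v t \<in> S"
  shows "((\<lambda>\<epsilon>. integral {0..T} (\<lambda>t. L (x t + \<epsilon> *\<^sub>R v t))) has_real_derivative
    integral {0..T} (\<lambda>t. D (x t) (v t))) (at 0)"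
proof -
  have mem: "x t + \<epsilon> *\<^sub>R v t \<in> S" if "t \<in> {0..T}" for t \<epsilon>
    using S x v that by (auto intro: subspace_add subspace_scale)
  have contL: "continuous_on S L"
    by (rule has_derivative_continuous_on[OF L])
  have "((\<lambda>\<epsilon>. integral (cbox 0 T) (\<lambda>t. L (x t + \<epsilon> *\<^sub>R v t))) has_field_derivative
    integral (cbox 0 T) (\<lambda>t. D (x t + 0 *\<^sub>R v t) (v t))) (at 0 within UNIV)"
  proof (rule leibniz_rule_field_derivative)
    show "((\<lambda>\<epsilon>. L (x t + \<epsilon> *\<^sub>R v t)) has_field_derivative D (x t + \<epsilon> *\<^sub>R v t) (v t)) (at \<epsilon> within UNIV)"
      if "t \<in> cbox 0 T" for \<epsilon> t
      using has_derivative_along_line[OF S x(2) v(2) L[OF mem]] that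
      by (simp add: has_real_derivative_iff_has_vector_derivative)
    have "continuous_on {0..T} (\<lambda>t. L (x t + \<epsilon> *\<^sub>R v t))" for \<epsilon>
      by (rule continuous_on_compose2[OF contL]) (auto intro!: continuous_intros x(1) v(1) mem)
    then show "(\<lambda>t. L (x t + \<epsilon> *\<^sub>R v t)) integrable_on cbox 0 T" for \<epsilon>
      by (simp add: integrable_continuous_interval)
    have xs: "continuous_on (UNIV \<times> {0..T}) (\<lambda>p. x (snd p))"
      and vs: "continuous_on (UNIV \<times> {0..T}) (\<lambda>p. v (snd p))"
      by (rule continuous_on_compose2[OF x(1)] continuous_on_compose2[OF v(1)];
          auto intro: continuous_intros)+
    have "continuous_on (UNIV \<times> {0..T}) (\<lambda>p. D (x (snd p) + fst p *\<^sub>R v (snd p)) (v (snd p)))"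
    proof (rule continuous_on_derivative_apply[where D=D and S=S])
      show "continuous_on (UNIV \<times> {0..T}) (\<lambda>p. x (snd p) + fst p *\<^sub>R v (snd p))"
        by (intro continuous_intros xs vs)
      show "linear (D y)" if "y \<in> S" for y
        using L[OF that] by (rule has_derivative_linear)
    qed (use mem vs D in auto)
    then show "continuous_on (UNIV \<times> cbox 0 T) (\<lambda>(\<epsilon>, t). D (x t + \<epsilon> *\<^sub>R v t) (v t))"
      by (simp add: case_prod_beta)
  qed auto
  then show ?thesis by simp
qed

subsection \<open>The fundamental lemma of the calculus of variations\<close>

text \<open>Supplies the test curves. Derivatives of polynomials are polynomials, so the family of
  iterated derivatives never breaks off.\<close>

lemma real_polynomial_function_smooth_on:
  fixes p :: "real \<Rightarrow> real" and B :: "'a::real_normed_vector"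
  assumes "real_polynomial_function p"
  shows "smooth_on S (\<lambda>t. p t *\<^sub>R B)"
proof -
  have poly: "real_polynomial_function ((deriv ^^ k) p)" for k
  proof (induction k)
    case (Suc k)
    then obtain q where "real_polynomial_function q"
      and "\<forall>t. ((deriv ^^ k) p has_real_derivative q t) (at t)"
      using has_real_derivative_polynomial_function by blast
    moreover from this have "deriv ((deriv ^^ k) p) = q"
      by (auto intro: DERIV_imp_deriv)
    ultimately show ?case by simp
  qed (use assms in simp)
  have der: "((deriv ^^ k) p has_real_derivative (deriv ^^ Suc k) p t) (at t)" for k t
    using has_real_derivative_polynomial_function[OF poly[of k]]
    by (auto simp: DERIV_deriv_iff_real_differentiable real_differentiable_def)
  \<comment> \<open>In one variable each direction contributes only a scalar factor, whence the
    product of the list.\<close>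
  define D where "D vs t = (prod_list vs * (deriv ^^ length vs) p t) *\<^sub>R B" for vs :: "real list" and t
  have "(D vs has_derivative (\<lambda>v. D (v # vs) t)) (at t within S)" for vs t
  proof -
    have "((\<lambda>t. (deriv ^^ length vs) p t) has_derivative
        (\<lambda>v. (deriv ^^ Suc (length vs)) p t * v)) (at t within S)"
      using der[of "length vs" t] by (simp add: has_field_derivative_def has_derivative_at_withinI)
    then have "((\<lambda>t. (prod_list vs * (deriv ^^ length vs) p t) *\<^sub>R B) has_derivative
        (\<lambda>v. (prod_list vs * ((deriv ^^ Suc (length vs)) p t * v)) *\<^sub>R B)) (at t within S)"
      by (intro derivative_intros)
    then show ?thesis
      unfolding D_def by (simp add: mult_ac)
  qed
  then show ?thesis
    unfolding smooth_on_def by (intro exI[of _ D]) (simp add: D_def)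
qed

text \<open>The test function is \<open>t (T - t) p t\<close> for a polynomial \<open>p\<close> uniformly close to \<open>h\<close>.\<close>

lemma fundamental_lemma_polynomial:
  fixes h :: "real \<Rightarrow> real"
  assumes h: "continuous_on {0..T} h" and T: "T > 0"
    and orth: "\<And>p. real_polynomial_function p \<Longrightarrow> p 0 = 0 \<Longrightarrow> p T = 0 \<Longrightarrow>
      integral {0..T} (\<lambda>t. p t * h t) = 0"
    and t: "t \<in> {0..T}"
  shows "h t = 0"
proof -
  define \<phi> where "\<phi> t = t * (T - t)" for t :: real
  have \<phi>: "real_polynomial_function \<phi>"
    unfolding \<phi>_def by (intro real_polynomial_function.intros real_polynomial_function_diff bounded_linear_ident)
  have cont\<phi>: "continuous_on {0..T} \<phi>"
    unfolding \<phi>_def by (intro continuous_intros)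
  have \<phi>0: "\<phi> t \<ge> 0" if "t \<in> {0..T}" for t
    using that by (simp add: \<phi>_def)
  define I where "I = integral {0..T} (\<lambda>t. \<phi> t * h t * h t)"
  define J where "J = integral {0..T} (\<lambda>t. \<phi> t * \<bar>h t\<bar>)"
  have J: "J \<ge> 0"
    unfolding J_def using \<phi>0 by (intro integral_nonneg integrable_continuous_interval)
      (auto intro!: continuous_intros h cont\<phi>)
  have small: "\<bar>I\<bar> \<le> e * J" if e: "e > 0" for e
  proof -
    obtain p where p: "real_polynomial_function p" and hp: "\<And>t. t \<in> {0..T} \<Longrightarrow> \<bar>h t - p t\<bar> < e"
      using Stone_Weierstrass_real_polynomial_function[OF compact_Icc h e] by blast
    have contp: "continuous_on {0..T} p"
      using p by (intro continuous_on_polymonial_function) (simp add: real_polynomial_function_eq)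
    \<comment> \<open>The product of \<open>\<phi>\<close> and \<open>p\<close> is an admissible
      test function, since \<open>\<phi>\<close> vanishes at both end points.\<close>
    have int0: "integral {0..T} (\<lambda>t. \<phi> t * p t * h t) = 0"
      using orth[of "\<lambda>t. \<phi> t * p t"] real_polynomial_function.intros(4)[OF \<phi> p] by (simp add: \<phi>_def)
    have "I = integral {0..T} (\<lambda>t. \<phi> t * h t * h t) - integral {0..T} (\<lambda>t. \<phi> t * p t * h t)"
      by (simp add: I_def int0)
    also have "\<dots> = integral {0..T} (\<lambda>t. \<phi> t * h t * h t - \<phi> t * p t * h t)"
      by (intro Henstock_Kurzweil_Integration.integral_diff[symmetric] integrable_continuous_interval continuous_intros h cont\<phi> contp)
    finally have I: "I = \<dots>" .
    have "norm I \<le> integral {0..T} (\<lambda>t. e * (\<phi> t * \<bar>h t\<bar>))"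
    unfolding I
    proof (rule integral_norm_bound_integral)
      show "norm (\<phi> s * h s * h s - \<phi> s * p s * h s) \<le> e * (\<phi> s * \<bar>h s\<bar>)" if s: "s \<in> {0..T}" for s
      proof -
        have "\<phi> s * h s * h s - \<phi> s * p s * h s = (h s - p s) * (\<phi> s * h s)"
          by (simp add: algebra_simps)
        then have "\<bar>\<phi> s * h s * h s - \<phi> s * p s * h s\<bar> = \<bar>h s - p s\<bar> * (\<phi> s * \<bar>h s\<bar>)"
          using \<phi>0[OF s] by (simp only: abs_mult abs_of_nonneg)
        then show ?thesis
          using hp[OF s] \<phi>0[OF s] by (simp add: mult_right_mono)
      qed
    qed (intro integrable_continuous_interval continuous_intros h cont\<phi> contp)+
    then show ?thesis by (simp add: J_def)
  qed
  have "I = 0"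
  proof (rule ccontr)
    assume "I \<noteq> 0"
    \<comment> \<open>This choice of \<open>e\<close> makes \<open>e * J\<close> smaller than the
      absolute value of \<open>I\<close>; adding 1 keeps the denominator positive when
      \<open>J\<close> is zero.\<close>
    then have "\<bar>I\<bar> \<le> \<bar>I\<bar> / (2 * (J + 1)) * J" using small[of "\<bar>I\<bar> / (2 * (J + 1))"] J by simp
    also have "\<dots> < \<bar>I\<bar>" using J \<open>I \<noteq> 0\<close> by (simp add: field_simps add_nonneg_pos)
    finally show False by simp
  qed
  moreover have "continuous_on {0..T} (\<lambda>t. \<phi> t * h t * h t)"
    by (intro continuous_intros h cont\<phi>)
  moreover have "\<phi> t * h t * h t \<ge> 0" if "t \<in> {0..T}" for t
    using \<phi>0[OF that] by (simp add: mult.assoc)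
  ultimately have zero: "\<forall>t\<in>{0..T}. \<phi> t * h t * h t = 0"
    unfolding I_def using integral_eq_0_iff T by blast
  \<comment> \<open>The factor \<open>\<phi>\<close> can be cancelled only in the open interval; the
    end points follow by continuity of \<open>h\<close>.\<close>
  have "h s = 0" if "s \<in> {0<..<T}" for s
    using bspec[OF zero, of s] that by (simp add: \<phi>_def)
  then show ?thesis
    using continuous_constant_on_closure[of "{0<..<T}" h 0 t] h T t by simp
qed

subsection \<open>Circulations and gradients\<close>

text \<open>Isolates what the algebra uses of the weighted cell volumes, so that measure theory is
  confined to one lemma.\<close>

definition pos_diagonal :: "real^'n^'n \<Rightarrow> bool" where
  "pos_diagonal W \<longleftrightarrow> (\<forall>i j. i \<noteq> j \<longrightarrow> W $ i $ j = 0) \<and> (\<forall>i. W $ i $ i > 0)"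

text \<open>Reading an entry as the flow from cell \<open>i\<close> to cell \<open>j\<close>,
  vanishing row sums are Kirchhoff's law at every cell.\<close>

definition circulations :: "('n \<Rightarrow> 'n set) \<Rightarrow> (real^'n^'n::finite) set"
  where "circulations nbr =
    {B. transpose B = - B \<and> B *v 1 = 0 \<and> (\<forall>i j. B $ i $ j \<noteq> 0 \<longrightarrow> j \<in> nbr i)}"

text \<open>The diagonal entries are nonnegative integrals. A zero value would make a function that
  is positive on the cell integrate to zero there, so the cell would be null, against its positive
  measure.\<close>

lemma pos_diagonal_cell_volumes:
  assumes "mesh \<D> C nbr" "weight_on \<D> \<sigma>"
  shows "pos_diagonal (cell_volumes \<sigma> C)"
proof -
  have "(LINT x:C i|lebesgue. \<sigma> x) > 0" for i
  proof -
    have C: "C i \<in> sets lebesgue" "C i \<subseteq> \<D>" "measure lebesgue (C i) > 0"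
      using assms(1) by (auto simp: mesh_def fmeasurableD)
    have int: "set_integrable lebesgue (C i) \<sigma>"
      using assms(2) C by (auto simp: weight_on_def intro: set_integrable_subset)
    have pos: "\<sigma> x > 0" if "x \<in> C i" for x
      using assms(2) C that by (auto simp: weight_on_def)
    have "(LINT x:C i|lebesgue. \<sigma> x) \<ge> 0"
      unfolding set_lebesgue_integral_def using pos
      by (intro integral_nonneg_AE) (auto simp: indicator_def less_imp_le)
    moreover have "(LINT x:C i|lebesgue. \<sigma> x) \<noteq> 0"
    proof
      assume 0: "(LINT x:C i|lebesgue. \<sigma> x) = 0"
      have "C i \<in> null_sets lebesgue"
      proof (rule null_if_pos_func_has_zero_int)
        show "integrable lebesgue (\<lambda>x. indicator (C i) x *\<^sub>R \<sigma> x)"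
          using int by (simp add: set_integrable_def)
        show "AE x\<in>C i in lebesgue. indicator (C i) x *\<^sub>R \<sigma> x > 0"
          using pos by auto
        show "(LINT x:C i|lebesgue. indicator (C i) x *\<^sub>R \<sigma> x) = 0"
          using 0 by (simp add: set_lebesgue_integral_def flip: mult.assoc indicator_inter_arith)
      qed (use C in auto)
      then show False
        using C(3) by (auto simp: null_sets_def measure_def)
    qed
    ultimately show ?thesis by simp
  qed
  then show ?thesis
    by (simp add: pos_diagonal_def cell_volumes_def)
qed

lemma pos_diagonal_mult_nth:
  assumes "pos_diagonal W"
  shows "(W ** X) $ i $ j = W $ i $ i * X $ i $ j" and "(W *v u) $ i = W $ i $ i * u $ i"
proof -
  have W: "(\<Sum>k\<in>UNIV. W $ i $ k * f k) = W $ i $ i * f i" for f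
  proof -
    have "(\<Sum>k\<in>UNIV. W $ i $ k * f k) = (\<Sum>k\<in>UNIV. if k = i then W $ i $ i * f i else 0)"
      using assms by (intro sum.cong) (auto simp: pos_diagonal_def)
    then show ?thesis by simp
  qed
  show "(W ** X) $ i $ j = W $ i $ i * X $ i $ j" "(W *v u) $ i = W $ i $ i * u $ i"
    by (simp_all add: matrix_matrix_mult_def matrix_vector_mult_def W)
qed

lemma transpose_pos_diagonal: "pos_diagonal W \<Longrightarrow> transpose W = W"
  by (simp add: pos_diagonal_def transpose_def vec_eq_iff) metis

lemma pos_diagonal_matrix_inv:
  fixes W :: "real^'n^'n"
  assumes "pos_diagonal W"
  shows "W ** matrix_inv W = mat 1"
proof -
  define W' :: "real^'n^'n" where "W' = (\<chi> i j. if i = j then 1 / W $ i $ i else 0)"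
  have "W ** W' = mat 1"
    using assms by (auto simp: vec_eq_iff pos_diagonal_mult_nth[OF assms] W'_def mat_def pos_diagonal_def less_imp_neq[symmetric])
  then have "W ** W' = mat 1 \<and> W' ** W = mat 1"
    by (simp add: matrix_left_right_inverse)
  \<comment> \<open>\<open>matrix_inv\<close> is a choice among two-sided inverses, so exhibiting
    one is enough.\<close>
  then have "W ** matrix_inv W = mat 1 \<and> matrix_inv W ** W = mat 1"
    unfolding matrix_inv_def by (rule someI)
  then show ?thesis by simp
qed

section \<open>The Lie algebra of discrete diffeomorphisms and its circulations\<close>

lemma subspace_discrete_diffs: "subspace (discrete_diffs W)"
proof -
  have "linear (\<lambda>A. A *v (1 :: real^'n))"
    by (intro bounded_linear.linear matrix_vector.bounded_linear_left)
  moreover have "linear (\<lambda>A. transpose A ** W + W ** A)"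
    by (simp add: linear_iff transpose_add transpose_scalar matrix_mult.add_left matrix_mult.add_right
        matrix_mult.scaleR_left matrix_mult.scaleR_right scaleR_add_right)
  ultimately show ?thesis
    unfolding discrete_diffs_def Collect_conj_eq by (intro subspace_inter linear_subspace_kernel)
qed

lemma subspace_discrete_diffs_UNIV: "subspace (discrete_diffs W \<times> (UNIV :: 'b::real_vector set))"
  by (intro subspace_Times subspace_discrete_diffs subspace_UNIV)

lemma discrete_diffs_transpose: "A \<in> discrete_diffs W \<Longrightarrow> transpose A ** W = - (W ** A)"
  by (simp add: discrete_diffs_def eq_neg_iff_add_eq_0)

text \<open>Moving \<open>W\<close> past two transposed factors costs two signs, which cancel; the
  remaining minus sign comes from the reversed order of the factors.\<close>

lemma commutator_discrete_diffs:
  assumes X: "X \<in> discrete_diffs W" and Y: "Y \<in> discrete_diffs W"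
  shows "commutator X Y \<in> discrete_diffs W"
proof -
  have "transpose (commutator X Y) ** W = transpose Y ** (transpose X ** W) - transpose X ** (transpose Y ** W)"
    by (simp add: commutator_def transpose_diff matrix_transpose_mul matrix_mult.diff_left matrix_mul_assoc)
  also have "\<dots> = - (transpose Y ** W ** X) + transpose X ** W ** Y"
    by (simp add: X Y discrete_diffs_transpose matrix_mult.minus_right matrix_mul_assoc)
  also have "\<dots> = - (W ** commutator X Y)"
    by (simp add: X Y discrete_diffs_transpose commutator_def matrix_mult.minus_left
        matrix_mult.diff_right matrix_mul_assoc)
  finally show ?thesis
    using X Y by (simp add: discrete_diffs_def commutator_def matrix_vector.diff_left
        matrix_vector.zero_right flip: matrix_vector_mul_assoc)
qed

text \<open>Left multiplication by \<open>W\<close> rescales rows by positive numbers, so it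
  preserves the support and the kernel condition, and it turns skewness relative to \<open>W\<close>
  into ordinary skewness.\<close>

lemma sparse_diffs_iff_circulation:
  assumes "pos_diagonal W"
  shows "Y \<in> sparse_diffs W nbr \<longleftrightarrow> W ** Y \<in> circulations nbr"
proof -
  have "W *v u = 0 \<longleftrightarrow> u = 0" for u
    using assms unfolding vec_eq_iff pos_diagonal_mult_nth[OF assms] pos_diagonal_def
    by (auto simp: less_imp_neq[symmetric])
  moreover have "W $ i $ i \<noteq> 0" for i
    using assms by (auto simp: pos_diagonal_def less_imp_neq[symmetric])
  ultimately show ?thesis
    by (simp add: sparse_diffs_def discrete_diffs_def circulations_def pos_diagonal_mult_nth[OF assms]
        matrix_transpose_mul transpose_pos_diagonal[OF assms] eq_neg_iff_add_eq_0
        flip: matrix_vector_mul_assoc)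
      blast
qed

lemma discrete_diffs_imp_circulation:
  assumes "pos_diagonal W" "Y \<in> discrete_diffs W"
  shows "W ** Y \<in> circulations (\<lambda>_. UNIV)"
  using assms sparse_diffs_iff_circulation[of W Y "\<lambda>_. UNIV"] by (simp add: sparse_diffs_def)

section \<open>Pairings as Euclidean inner products with circulations\<close>

lemma pairing_form_eq_inner: "pairing_form W K Z = K \<bullet> (W ** Z)"
  by (simp add: pairing_form_def inner_matrix_eq_trace matrix_mul_assoc)

text \<open>On the right-hand side one sees that the commutator term is skew whenever \<open>K\<close> is.\<close>

lemma commutator_term_eq:
  assumes "pos_diagonal W" "A \<in> discrete_diffs W"
  shows "commutator (K ** W) A ** matrix_inv W = - (K ** transpose A + A ** K)"
proof -
  have "commutator (K ** W) A ** matrix_inv W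
      = K ** (W ** A) ** matrix_inv W - A ** K ** (W ** matrix_inv W)"
    by (simp add: commutator_def matrix_mult.diff_left matrix_mul_assoc)
  also have "W ** A = - (transpose A ** W)"
    using assms by (simp add: discrete_diffs_transpose)
  also have "K ** - (transpose A ** W) ** matrix_inv W = - (K ** transpose A ** (W ** matrix_inv W))"
    by (simp add: matrix_mult.minus_left matrix_mult.minus_right matrix_mul_assoc)
  finally show ?thesis
    using assms by (simp add: pos_diagonal_matrix_inv)
qed

text \<open>Frees \<open>Y\<close> from the commutator by cyclicity of the trace. The minus sign
  arises because the pairing transposes its first argument, which is skew.\<close>

lemma pairing_form_commutator:
  assumes W: "pos_diagonal W" and K: "K \<in> one_forms" and A: "A \<in> discrete_diffs W"
  shows "pairing_form W K (commutator Y A) = - pairing_form W (commutator (K ** W) A ** matrix_inv W) Y"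
proof -
  define M where "M = commutator (K ** W) A ** matrix_inv W"
  have K': "transpose K = - K"
    using K by (simp add: one_forms_def)
  have M': "transpose M = - M"
    by (simp add: M_def commutator_term_eq[OF W A] K' transpose_diff transpose_minus
        matrix_transpose_mul matrix_mult.minus_left matrix_mult.minus_right)
  have "matrix_inv W ** W = mat 1"
    using pos_diagonal_matrix_inv[OF W] by (simp add: matrix_left_right_inverse)
  then have MW: "M ** W = commutator (K ** W) A"
    by (simp add: M_def flip: matrix_mul_assoc)
  have "pairing_form W K (commutator Y A) = trace (- (K ** W ** Y ** A)) + trace ((K ** W ** A) ** Y)"
    by (simp add: pairing_form_def K' commutator_def matrix_mult.minus_left matrix_mult.diff_right
        matrix_mul_assoc flip: trace_add)
  also have "trace (- (K ** W ** Y ** A)) = - trace (A ** (K ** W ** Y))"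
    unfolding trace_mul_sym[of A] by (simp add: trace_def sum_negf)
  also have "- trace (A ** (K ** W ** Y)) + trace (K ** W ** A ** Y) = trace (M ** W ** Y)"
    unfolding MW by (simp add: commutator_def matrix_mult.diff_left trace_sub matrix_mul_assoc)
  also have "\<dots> = - pairing_form W M Y"
    by (simp add: pairing_form_def M' matrix_mult.minus_left trace_def sum_negf)
  finally show ?thesis
    by (simp add: M_def)
qed

text \<open>Only the skew part of a matrix contributes to its inner product with a skew
  matrix.\<close>

lemma inner_skew_eq:
  fixes B :: "real^'n^'n"
  assumes B: "transpose B = - B"
  shows "(\<chi> i j. f i j) \<bullet> B = (1/2) * ((\<chi> i j. f i j - f j i) \<bullet> B)"
proof -
  have B': "B $ i $ j = - B $ j $ i" for i j
    using arg_cong[OF B, of "\<lambda>M. M $ j $ i"] by (simp add: transpose_def)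
  have "(\<Sum>i\<in>UNIV. \<Sum>j\<in>UNIV. f i j * B $ i $ j) = (\<Sum>i\<in>UNIV. \<Sum>j\<in>UNIV. f j i * B $ j $ i)"
    by (rule sum.swap)
  also have "\<dots> = (\<Sum>i\<in>UNIV. \<Sum>j\<in>UNIV. - (f j i * B $ i $ j))"
    by (subst B') simp
  finally show ?thesis
    by (simp add: inner_matrix_eq_sum left_diff_distrib sum_subtractf sum_negf)
qed

lemma inner_circulation_row_const:
  assumes "(B :: real^'n^'n) *v 1 = 0"
  shows "(\<chi> i j. f i) \<bullet> B = 0"
proof -
  have "(\<Sum>j\<in>UNIV. B $ i $ j) = 0" for i
    using assms by (simp add: matrix_vector_mult_def vec_eq_iff)
  then show ?thesis
    by (simp add: inner_matrix_eq_sum flip: sum_distrib_left)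
qed

text \<open>A gradient is twice the skew part of a matrix with constant rows, and such a matrix is
  orthogonal to vanishing row sums. Hence \<open>P\<close> drops out when tested against
  circulations.\<close>

lemma inner_discrete_d_circulation:
  assumes "B \<in> circulations nbr"
  shows "discrete_d P \<bullet> B = 0"
proof -
  have "(\<chi> i j. P $ i) \<bullet> B = 0"
    using assms by (intro inner_circulation_row_const) (simp add: circulations_def)
  then show ?thesis
    using assms inner_skew_eq[of B "\<lambda>i j. P $ i"] by (simp add: circulations_def discrete_d_def)
qed

text \<open>The one-form through which the variation of \<open>\<Theta>\<close> pairs with
  \<open>Y\<close>.\<close>

definition advection_form :: "real^'n \<Rightarrow> real^'n \<Rightarrow> real^'n^'n" where
  "advection_form g \<Theta> = (\<chi> i j. 1/2 * (g $ i + g $ j) * (\<Theta> $ j - \<Theta> $ i))"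

text \<open>Zero row sums of \<open>W Y\<close> allow one to replace \<open>\<Theta>\<^sub>j\<close> by \<open>\<Theta>\<^sub>j - \<Theta>\<^sub>i\<close>,
  and its skew symmetry then symmetrises \<open>g\<^sub>i\<close>.\<close>

lemma pairing_fun_mult_vec:
  assumes "pos_diagonal W" "Y \<in> discrete_diffs W"
  shows "pairing_fun W g (Y *v \<Theta>) = pairing_form W (advection_form g \<Theta>) Y"
proof -
  define B where "B = W ** Y"
  have B: "transpose B = - B" "B *v 1 = 0"
    using discrete_diffs_imp_circulation[OF assms] by (auto simp: circulations_def B_def)
  have "pairing_fun W g (Y *v \<Theta>) = (\<chi> i j. g $ i * \<Theta> $ j) \<bullet> B"
    unfolding pairing_fun_def matrix_vector_mul_assoc B_def[symmetric]
    by (simp add: inner_matrix_eq_sum inner_vec_def[of g] matrix_vector_mult_def sum_distrib_left mult_ac)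
  also have "\<dots> = (\<chi> i j. g $ i * \<Theta> $ j) \<bullet> B - (\<chi> i j. g $ i * \<Theta> $ i) \<bullet> B"
    by (simp add: inner_circulation_row_const[OF B(2), of "\<lambda>i. g $ i * \<Theta> $ i"])
  also have "\<dots> = (\<chi> i j. g $ i * (\<Theta> $ j - \<Theta> $ i)) \<bullet> B"
    by (simp add: inner_matrix_eq_sum right_diff_distrib left_diff_distrib sum_subtractf)
  also have "\<dots> = advection_form g \<Theta> \<bullet> B"
    unfolding inner_skew_eq[OF B(1), of "\<lambda>i j. g $ i * (\<Theta> $ j - \<Theta> $ i)"]
    by (simp add: inner_matrix_eq_sum advection_form_def sum_distrib_left diff_divide_distrib algebra_simps)
  finally show ?thesis
    by (simp add: pairing_form_eq_inner B_def)
qed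

text \<open>A discrete Hodge decomposition: the component of \<open>E\<close>, restricted to the edges, that is
  orthogonal to the gradients is itself a circulation.\<close>

lemma orthogonal_circulations_imp_gradient:
  fixes nbr :: "'n::finite \<Rightarrow> 'n set"
  assumes sym: "\<And>i j. j \<in> nbr i \<Longrightarrow> i \<in> nbr j"
    and E: "transpose E = - E" and orth: "\<And>B. B \<in> circulations nbr \<Longrightarrow> E \<bullet> B = 0"
  obtains P where "\<And>i j. j \<in> nbr i \<Longrightarrow> E $ i $ j = discrete_d P $ i $ j"
proof -
  \<comment> \<open>\<open>m\<close> discards the entries off the edges, about which orthogonality
    to circulations says nothing.\<close>
  define m :: "real^'n^'n \<Rightarrow> real^'n^'n" where "m X = (\<chi> i j. if j \<in> nbr i then X $ i $ j else 0)" for X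
  define U where "U = range (\<lambda>F. m (discrete_d F))"
  have "linear (\<lambda>F. m (discrete_d F))"
    by (auto simp: linear_iff m_def discrete_d_def vec_eq_iff algebra_simps)
  then have U: "subspace U"
    unfolding U_def by (rule linear_subspace_image) simp
  obtain u z where u: "u \<in> U" and z: "\<And>w. w \<in> U \<Longrightarrow> orthogonal z w" and uz: "m E = u + z"
    using orthogonal_subspace_decomp_exists[of U "m E"] span_eq_iff[THEN iffD2, OF U] by metis
  obtain P where P: "u = m (discrete_d P)"
    using u by (auto simp: U_def)
  have "z = m E - u"
    using uz by simp
  then have zm: "z = m (E - discrete_d P)"
    by (simp add: P m_def vec_eq_iff)
  have m_sym: "j \<in> nbr i \<longleftrightarrow> i \<in> nbr j" for i j
    using sym by blast
  have E': "E $ i $ j = - E $ j $ i" for i j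
    using arg_cong[OF E, of "\<lambda>M. M $ j $ i"] by (simp add: transpose_def)
  have z': "z $ j $ i = - z $ i $ j" for i j
    using m_sym[of i j] E'[of i j] by (simp add: zm m_def discrete_d_def)
  have z_skew: "transpose z = - z"
    by (auto simp: transpose_def vec_eq_iff intro: z')
  have inner_m: "m X \<bullet> Z = X \<bullet> Z" if "\<And>i j. Z $ i $ j \<noteq> 0 \<Longrightarrow> j \<in> nbr i" for X Z
    unfolding inner_matrix_eq_sum m_def using that by (intro sum.cong) auto
  have z_supp: "j \<in> nbr i" if "z $ i $ j \<noteq> 0" for i j
    using that by (auto simp: zm m_def split: if_splits)
  \<comment> \<open>Summation by parts: being orthogonal to all gradients, the skew matrix
    \<open>z\<close> has zero divergence, that is, vanishing row sums.\<close>
  have "(z *v 1) \<bullet> F = 0" for F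
  proof -
    have "0 = m (discrete_d F) \<bullet> z"
      using z[of "m (discrete_d F)"] by (simp add: U_def orthogonal_def inner_commute)
    also have "\<dots> = discrete_d F \<bullet> z"
      using z_supp by (rule inner_m)
    also have "\<dots> = 2 * ((\<chi> i j. F $ i) \<bullet> z)"
      by (simp add: inner_skew_eq[OF z_skew, of "\<lambda>i j. F $ i"] discrete_d_def)
    also have "(\<chi> i j. F $ i) \<bullet> z = (z *v 1) \<bullet> F"
      by (simp add: inner_matrix_eq_sum inner_vec_def matrix_vector_mult_def sum_distrib_left mult.commute)
    finally show ?thesis by simp
  qed
  from this[of "z *v 1"] have "z *v 1 = 0" by simp
  then have circ: "z \<in> circulations nbr"
    using z_skew z_supp by (simp add: circulations_def)
  \<comment> \<open>\<open>z\<close> is orthogonal to \<open>m E\<close> as a circulation supported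
    on the edges, and to \<open>u\<close> by the decomposition.\<close>
  have "z \<bullet> z = m E \<bullet> z - u \<bullet> z"
    by (simp add: uz inner_add_left)
  also have "\<dots> = 0"
    using orth[OF circ] inner_m[of z E] z_supp z[OF u]
    by (simp add: orthogonal_def inner_commute)
  finally have "z = 0" by simp
  then have mE: "m E = m (discrete_d P)"
    using uz P by simp
  show thesis
  proof (rule that)
    show "E $ i $ j = discrete_d P $ i $ j" if "j \<in> nbr i" for i j
      using arg_cong[OF mE, of "\<lambda>X. X $ i $ j"] that by (simp add: m_def)
  qed
qed

subsection \<open>The first variation\<close>

lemma functional_derivatives_apply:
  assumes "functional_derivatives W L A \<Theta> K g" "A \<in> discrete_diffs W" "Z \<in> discrete_diffs W"
    and "(L has_derivative D) (at (A, \<Theta>) within discrete_diffs W \<times> UNIV)"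
  shows "D (Z, u) = pairing_form W K Z + pairing_fun W g u"
proof -
  obtain DL where DL: "(L has_derivative DL) (at (A, \<Theta>) within discrete_diffs W \<times> UNIV)"
    and eq: "DL (Z, u) = pairing_form W K Z + pairing_fun W g u"
    using assms(1,3) by (auto simp: functional_derivatives_def)
  have "D (Z, u) = DL (Z, u)"
    using assms by (intro has_derivative_subspace_unique[OF subspace_discrete_diffs_UNIV _ _ assms(4) DL]) auto
  then show ?thesis
    using eq by simp
qed

locale discrete_curve =
  fixes W :: "real^'n^'n::finite" and L :: "(real^'n^'n) \<times> (real^'n) \<Rightarrow> real" and T :: real
    and A :: "real \<Rightarrow> real^'n^'n" and \<Theta> :: "real \<Rightarrow> real^'n"
    and K :: "real \<Rightarrow> real^'n^'n" and g :: "real \<Rightarrow> real^'n"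
  assumes W: "pos_diagonal W" and L_smooth: "smooth_on (discrete_diffs W \<times> UNIV) L" and T: "T > 0"
    and A_smooth: "smooth_on {0..T} A" and \<Theta>_smooth: "smooth_on {0..T} \<Theta>"
    and A: "\<And>t. t \<in> {0..T} \<Longrightarrow> A t \<in> discrete_diffs W"
    and K_smooth: "smooth_on {0..T} K"
    and fd: "\<And>t. t \<in> {0..T} \<Longrightarrow> functional_derivatives W L (A t) (\<Theta> t) (K t) (g t)"
begin

abbreviation K' :: "real \<Rightarrow> real^'n^'n" where
  "K' t \<equiv> vector_derivative K (at t within {0..T})"

definition EL :: "real \<Rightarrow> real^'n^'n" where
  "EL t = K' t + commutator (K t ** W) (A t) ** matrix_inv W - advection_form (g t) (\<Theta> t)"

lemmas K' = smooth_on_has_vector_derivative[OF K_smooth T]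

lemma K_one_form: "t \<in> {0..T} \<Longrightarrow> K t \<in> one_forms"
  using fd by (auto simp: functional_derivatives_def)

text \<open>Makes the Hodge decomposition applicable. The velocity of \<open>K\<close> is skew
  because the one-forms are a linear subspace.\<close>

lemma transpose_EL:
  assumes t: "t \<in> {0..T}"
  shows "transpose (EL t) = - EL t"
proof -
  have "subspace (one_forms :: (real^'n^'n) set)"
    by (auto simp: subspace_def one_forms_def transpose_add transpose_scalar transpose_zero)
  then have "K' t \<in> one_forms"
    using has_vector_derivative_in_subspace[OF _ K_one_form K'(1)[OF t] t T] by blast
  moreover have "transpose (advection_form (g t) (\<Theta> t)) = - advection_form (g t) (\<Theta> t)"
    by (simp add: advection_form_def transpose_def vec_eq_iff algebra_simps)
  ultimately show ?thesis
    using K_one_form[OF t]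
    by (simp add: EL_def commutator_term_eq[OF W A[OF t]] one_forms_def transpose_add transpose_diff
        transpose_minus matrix_transpose_mul matrix_mult.minus_left matrix_mult.minus_right)
qed

text \<open>Here \<open>Z\<close> plays the velocity of \<open>Y\<close>. The term with
  \<open>K'\<close> is added and subtracted so that the bracket becomes the time derivative of the
  inner product of \<open>K\<close> and \<open>W ** Y\<close>.\<close>

lemma derivative_variation:
  assumes t: "t \<in> {0..T}" and Y: "Y \<in> discrete_diffs W" and Z: "Z \<in> discrete_diffs W"
    and D: "(L has_derivative D) (at (A t, \<Theta> t) within discrete_diffs W \<times> UNIV)"
  shows "D (Z + commutator Y (A t), Y *v \<Theta> t) =
    (K t \<bullet> (W ** Z) + K' t \<bullet> (W ** Y)) - EL t \<bullet> (W ** Y)"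
proof -
  have "D (Z + commutator Y (A t), Y *v \<Theta> t) =
      pairing_form W (K t) (Z + commutator Y (A t)) + pairing_fun W (g t) (Y *v \<Theta> t)"
    using subspace_add[OF subspace_discrete_diffs Z commutator_discrete_diffs[OF Y A[OF t]]]
    by (rule functional_derivatives_apply[OF fd[OF t] A[OF t] _ D])
  also have "\<dots> = K t \<bullet> (W ** Z) + pairing_form W (K t) (commutator Y (A t))
      + advection_form (g t) (\<Theta> t) \<bullet> (W ** Y)"
    by (simp add: pairing_fun_mult_vec[OF W Y] pairing_form_eq_inner matrix_mult.add_right inner_add_right)
  also have "pairing_form W (K t) (commutator Y (A t)) =
      - ((commutator (K t ** W) (A t) ** matrix_inv W) \<bullet> (W ** Y))"
    using pairing_form_commutator[OF W K_one_form[OF t] A[OF t], of Y]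
    by (simp add: pairing_form_eq_inner)
  finally show ?thesis
    by (simp add: EL_def inner_add_left inner_diff_left)
qed

lemma continuous_on_curve_derivative:
  assumes D: "\<And>x. x \<in> discrete_diffs W \<times> UNIV \<Longrightarrow>
      (L has_derivative D x) (at x within discrete_diffs W \<times> UNIV)"
    and D_cont: "\<And>v. continuous_on (discrete_diffs W \<times> UNIV) (\<lambda>x. D x v)"
    and v: "continuous_on {0..T} v"
  shows "continuous_on {0..T} (\<lambda>t. D (A t, \<Theta> t) (v t))"
proof (rule continuous_on_derivative_apply[where D=D and S="discrete_diffs W \<times> UNIV"])
  show "linear (D x)" if "x \<in> discrete_diffs W \<times> UNIV" for x
    using D[OF that] by (rule has_derivative_linear)
  show "continuous_on {0..T} (\<lambda>t. (A t, \<Theta> t))"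
    by (intro continuous_on_Pair smooth_on_continuous_on A_smooth \<Theta>_smooth)
qed (use A D_cont v in auto)

lemma continuous_on_variation:
  assumes "continuous_on {0..T} Z" "continuous_on {0..T} Y"
  shows "continuous_on {0..T} (\<lambda>t. (Z t + commutator (Y t) (A t), Y t *v \<Theta> t))"
  unfolding commutator_def
  by (intro continuous_intros assms smooth_on_continuous_on[OF A_smooth]
      smooth_on_continuous_on[OF \<Theta>_smooth] matrix_mult.continuous_on matrix_vector.continuous_on)

text \<open>No continuity of \<open>g\<close> is assumed. The case \<open>Z = 0\<close> of
  \<open>derivative_variation\<close> expresses the inner product through \<open>K'\<close> and the
  derivative of \<open>L\<close>, both continuous along the curve.\<close>

lemma continuous_on_EL_inner:
  assumes Y: "Y \<in> discrete_diffs W"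
  shows "continuous_on {0..T} (\<lambda>t. EL t \<bullet> (W ** Y))"
proof -
  obtain D where D: "\<And>x. x \<in> discrete_diffs W \<times> UNIV \<Longrightarrow>
      (L has_derivative D x) (at x within discrete_diffs W \<times> UNIV)"
    and D_cont: "\<And>v. continuous_on (discrete_diffs W \<times> UNIV) (\<lambda>x. D x v)"
    using smooth_on_imp_derivative[OF L_smooth] by blast
  have "continuous_on {0..T}
      (\<lambda>t. K' t \<bullet> (W ** Y) - D (A t, \<Theta> t) (0 + commutator Y (A t), Y *v \<Theta> t))"
    by (intro continuous_on_diff continuous_on_inner continuous_on_const K'(2)
        continuous_on_curve_derivative[OF D D_cont] continuous_on_variation)
  moreover have "K' t \<bullet> (W ** Y) - D (A t, \<Theta> t) (0 + commutator Y (A t), Y *v \<Theta> t) = EL t \<bullet> (W ** Y)"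
    if "t \<in> {0..T}" for t
    using derivative_variation[OF that Y subspace_0[OF subspace_discrete_diffs] D] A[OF that] by simp
  ultimately show ?thesis
    by (rule continuous_on_eq)
qed

text \<open>The integrand is a total time derivative minus
  \<open>EL t \<bullet> (W ** Y t)\<close>.\<close>

lemma first_variation:
  assumes Y: "smooth_on {0..T} Y" "\<And>t. t \<in> {0..T} \<Longrightarrow> Y t \<in> discrete_diffs W" "Y 0 = 0" "Y T = 0"
  shows "has_first_variation L T A \<Theta>
      (\<lambda>t. vector_derivative Y (at t within {0..T}) + commutator (Y t) (A t)) (\<lambda>t. Y t *v \<Theta> t)
      (- integral {0..T} (\<lambda>t. EL t \<bullet> (W ** Y t)))"
proof -
  define Y' where "Y' t = vector_derivative Y (at t within {0..T})" for t
  note Yd = smooth_on_has_vector_derivative[OF Y(1) T, folded Y'_def]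
  have Y': "Y' t \<in> discrete_diffs W" if "t \<in> {0..T}" for t
    using has_vector_derivative_in_subspace[OF subspace_discrete_diffs Y(2) Yd(1)[OF that] that T] by simp
  define v where "v t = (Y' t + commutator (Y t) (A t), Y t *v \<Theta> t)" for t
  have v: "continuous_on {0..T} v"
    unfolding v_def by (intro continuous_on_variation Yd(2) smooth_on_continuous_on[OF Y(1)])
  have vS: "v t \<in> discrete_diffs W \<times> UNIV" if "t \<in> {0..T}" for t
    using Y'[OF that] commutator_discrete_diffs[OF Y(2) A, OF that that]
    by (simp add: v_def subspace_add subspace_discrete_diffs)
  obtain D where D: "\<And>x. x \<in> discrete_diffs W \<times> UNIV \<Longrightarrow>
      (L has_derivative D x) (at x within discrete_diffs W \<times> UNIV)"
    and D_cont: "\<And>v. continuous_on (discrete_diffs W \<times> UNIV) (\<lambda>x. D x v)"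
    using smooth_on_imp_derivative[OF L_smooth] by blast
  define I where "I = integral {0..T} (\<lambda>t. D (A t, \<Theta> t) (v t))"
  have "((\<lambda>\<epsilon>. integral {0..T} (\<lambda>t. L ((A t, \<Theta> t) + \<epsilon> *\<^sub>R v t))) has_real_derivative I) (at 0)"
    unfolding I_def using A vS
    by (intro first_variation_integral[OF subspace_discrete_diffs_UNIV D D_cont] v continuous_on_Pair
        smooth_on_continuous_on[OF A_smooth] smooth_on_continuous_on[OF \<Theta>_smooth]) auto
  then have I: "has_first_variation L T A \<Theta> (\<lambda>t. Y' t + commutator (Y t) (A t)) (\<lambda>t. Y t *v \<Theta> t) I"
    by (simp add: has_first_variation_def action_def v_def)
  have "((\<lambda>t. D (A t, \<Theta> t) (v t)) has_integral I) {0..T}"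
    unfolding I_def
    by (intro integrable_integral integrable_continuous_interval continuous_on_curve_derivative[OF D D_cont] v)
  \<comment> \<open>Integration by parts; the boundary values vanish later because \<open>Y\<close>
    is zero at both ends.\<close>
  moreover have "((\<lambda>t. K t \<bullet> (W ** Y' t) + K' t \<bullet> (W ** Y t)) has_integral
      K T \<bullet> (W ** Y T) - K 0 \<bullet> (W ** Y 0)) {0..T}"
  proof (rule fundamental_theorem_of_calculus)
    fix t assume t: "t \<in> {0..T}"
    have "((\<lambda>t. W ** Y t) has_vector_derivative W ** Y' t) (at t within {0..T})"
      by (rule bounded_linear.has_vector_derivative[OF matrix_mult.bounded_linear_right Yd(1)[OF t]])
    then show "((\<lambda>t. K t \<bullet> (W ** Y t)) has_vector_derivative
        K t \<bullet> (W ** Y' t) + K' t \<bullet> (W ** Y t)) (at t within {0..T})"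
      by (rule bounded_bilinear.has_vector_derivative[OF bounded_bilinear_inner K'(1)[OF t]])
  qed (use T in simp)
  ultimately have int: "((\<lambda>t. K t \<bullet> (W ** Y' t) + K' t \<bullet> (W ** Y t) - D (A t, \<Theta> t) (v t)) has_integral - I) {0..T}"
    using has_integral_diff[of _ 0 _ _ I] by (simp add: Y(3,4))
  have "((\<lambda>t. EL t \<bullet> (W ** Y t)) has_integral - I) {0..T}"
  proof (rule has_integral_eq[OF _ int])
    show "K t \<bullet> (W ** Y' t) + K' t \<bullet> (W ** Y t) - D (A t, \<Theta> t) (v t) = EL t \<bullet> (W ** Y t)"
      if "t \<in> {0..T}" for t
      using derivative_variation[OF that Y(2)[OF that] Y'[OF that] D] A[OF that] by (simp add: v_def)
  qed
  then have "I = - integral {0..T} (\<lambda>t. EL t \<bullet> (W ** Y t))"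
    by (simp add: integral_unique)
  then show ?thesis
    using I by (simp add: Y'_def)
qed

section \<open>Criticality and the discrete equation\<close>

lemma sparse_diffs_subset: "sparse_diffs W nbr \<subseteq> discrete_diffs W"
  by (auto simp: sparse_diffs_def)

text \<open>The test curves are a fixed matrix \<open>Z\<close>, with \<open>W ** Z = B\<close>,
  times a polynomial vanishing at the end points. The fundamental lemma then localises in
  time.\<close>

lemma critical_imp_orthogonal:
  assumes crit: "critical W nbr L T A \<Theta>" and B: "B \<in> circulations nbr" and t: "t \<in> {0..T}"
  shows "EL t \<bullet> B = 0"
proof -
  define Z where "Z = matrix_inv W ** B"
  have WZ: "W ** Z = B"
    by (simp add: Z_def matrix_mul_assoc pos_diagonal_matrix_inv[OF W])
  then have Z: "Z \<in> sparse_diffs W nbr"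
    using B by (simp add: sparse_diffs_iff_circulation[OF W])
  have sub: "c *\<^sub>R Z \<in> sparse_diffs W nbr" for c
    using Z subspace_scale[OF subspace_discrete_diffs, of Z W c] by (auto simp: sparse_diffs_def)
  have "EL t \<bullet> (W ** Z) = 0"
  proof (rule fundamental_lemma_polynomial[OF _ T _ t])
    show "continuous_on {0..T} (\<lambda>t. EL t \<bullet> (W ** Z))"
      using Z sparse_diffs_subset by (intro continuous_on_EL_inner) auto
    fix p :: "real \<Rightarrow> real"
    assume p: "real_polynomial_function p" "p 0 = 0" "p T = 0"
    let ?Y = "\<lambda>t. p t *\<^sub>R Z"
    have Y: "smooth_on {0..T} ?Y"
      by (rule real_polynomial_function_smooth_on[OF p(1)])
    have fv: "has_first_variation L T A \<Theta>
      (\<lambda>t. vector_derivative ?Y (at t within {0..T}) + commutator (?Y t) (A t)) (\<lambda>t. ?Y t *v \<Theta> t)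
      (- integral {0..T} (\<lambda>t. EL t \<bullet> (W ** ?Y t)))"
      using p sub sparse_diffs_subset by (intro first_variation Y) auto
    have fv0: "has_first_variation L T A \<Theta>
      (\<lambda>t. vector_derivative ?Y (at t within {0..T}) + commutator (?Y t) (A t)) (\<lambda>t. ?Y t *v \<Theta> t) 0"
      using crit Y p sub unfolding critical_def by simp
    have "- integral {0..T} (\<lambda>t. EL t \<bullet> (W ** ?Y t)) = 0"
      using fv fv0 unfolding has_first_variation_def by (rule DERIV_unique)
    then show "integral {0..T} (\<lambda>t. p t * (EL t \<bullet> (W ** Z))) = 0"
      by (simp add: matrix_mult.scaleR_right)
  qed
  then show ?thesis
    by (simp add: WZ)
qed

lemma critical_iff_gradient:
  assumes sym: "\<And>i j. j \<in> nbr i \<Longrightarrow> i \<in> nbr j"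
  shows "critical W nbr L T A \<Theta> \<longleftrightarrow>
    (\<exists>P. \<forall>t\<in>{0..T}. \<forall>i. \<forall>j\<in>nbr i. EL t $ i $ j + discrete_d (P t) $ i $ j = 0)"
proof
  assume crit: "critical W nbr L T A \<Theta>"
  have "\<exists>P. \<forall>i. \<forall>j\<in>nbr i. EL t $ i $ j + discrete_d P $ i $ j = 0" if t: "t \<in> {0..T}" for t
  proof -
    obtain P where "\<And>i j. j \<in> nbr i \<Longrightarrow> EL t $ i $ j = discrete_d P $ i $ j"
      using orthogonal_circulations_imp_gradient[of nbr, OF sym transpose_EL[OF t] critical_imp_orthogonal[OF crit _ t]]
      by blast
    then show ?thesis
      \<comment> \<open>The decomposition yields \<open>EL\<close> as a gradient, whereas the
        equation has the gradient on the same side, hence the sign.\<close>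
      by (intro exI[of _ "- P"]) (simp add: discrete_d_def)
  qed
  then show "\<exists>P. \<forall>t\<in>{0..T}. \<forall>i. \<forall>j\<in>nbr i. EL t $ i $ j + discrete_d (P t) $ i $ j = 0"
    by (intro bchoice) blast
next
  assume "\<exists>P. \<forall>t\<in>{0..T}. \<forall>i. \<forall>j\<in>nbr i. EL t $ i $ j + discrete_d (P t) $ i $ j = 0"
  then obtain P where P: "\<And>t i j. t \<in> {0..T} \<Longrightarrow> j \<in> nbr i \<Longrightarrow> EL t $ i $ j + discrete_d (P t) $ i $ j = 0"
    by blast
  show "critical W nbr L T A \<Theta>"
    unfolding critical_def
  proof (intro allI impI, elim conjE)
    fix Y assume Y: "smooth_on {0..T} Y" "\<forall>t\<in>{0..T}. Y t \<in> sparse_diffs W nbr" "Y 0 = 0" "Y T = 0"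
    have "EL t \<bullet> (W ** Y t) = 0" if t: "t \<in> {0..T}" for t
    proof -
      have circ: "W ** Y t \<in> circulations nbr"
        using Y(2) t by (simp add: sparse_diffs_iff_circulation[OF W])
      \<comment> \<open>Every summand vanishes: on edges by the equation, off the edges because
        \<open>W ** Y t\<close> is zero there.\<close>
      have "(EL t + discrete_d (P t)) \<bullet> (W ** Y t) = 0"
        unfolding inner_matrix_eq_sum
      proof (intro sum.neutral ballI)
        fix i j
        show "(EL t + discrete_d (P t)) $ i $ j * (W ** Y t) $ i $ j = 0"
        proof (cases "j \<in> nbr i")
          case True
          then show ?thesis using P[OF t, of j i] by simp
        next
          case False
          then show ?thesis using circ by (auto simp: circulations_def)
        qed
      qed
      then show ?thesis
        by (simp add: inner_add_left inner_discrete_d_circulation[OF circ])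
    qed
    then have "integral {0..T} (\<lambda>t. EL t \<bullet> (W ** Y t)) = 0"
      using integral_cong[of "{0..T}" "\<lambda>t. EL t \<bullet> (W ** Y t)" "\<lambda>_. 0"] by simp
    moreover have "has_first_variation L T A \<Theta>
      (\<lambda>t. vector_derivative Y (at t within {0..T}) + commutator (Y t) (A t)) (\<lambda>t. Y t *v \<Theta> t)
      (- integral {0..T} (\<lambda>t. EL t \<bullet> (W ** Y t)))"
      using Y by (intro first_variation) (auto simp: sparse_diffs_def)
    ultimately show "has_first_variation L T A \<Theta>
      (\<lambda>t. vector_derivative Y (at t within {0..T}) + commutator (Y t) (A t)) (\<lambda>t. Y t *v \<Theta> t) 0"
      by simp
  qed
qed

text \<open>The equation differentiates single entries of \<open>K\<close>, \<open>EL\<close> the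
  whole matrix; taking an entry is bounded linear and commutes with the derivative.\<close>

lemma EL_nth:
  assumes t: "t \<in> {0..T}"
  shows "EL t $ i $ j = vector_derivative (\<lambda>s. K s $ i $ j) (at t within {0..T})
       + (commutator (K t ** W) (A t) ** matrix_inv W) $ i $ j
       - 1/2 * (g t $ i + g t $ j) * (\<Theta> t $ j - \<Theta> t $ i)"
proof -
  have "((\<lambda>s. K s $ i $ j) has_vector_derivative K' t $ i $ j) (at t within {0..T})"
    by (intro bounded_linear.has_vector_derivative[OF bounded_linear_vec_nth]
        bounded_linear.has_vector_derivative[OF bounded_linear_vec_nth] K'(1)[OF t])
  then have "vector_derivative (\<lambda>s. K s $ i $ j) (at t within {0..T}) = K' t $ i $ j"
    by (rule vector_derivative_within_closed_interval[OF T t])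
  then show ?thesis
    by (simp add: EL_def advection_form_def)
qed

end

theorem proposition4p1:
  fixes \<D> :: "'a::euclidean_space set"
    and C :: "'n::finite \<Rightarrow> 'a set"
    and nbr :: "'n \<Rightarrow> 'n set"
    and \<sigma> :: "'a \<Rightarrow> real"
    and \<Omega> :: "real^'n^'n"
    and L :: "(real^'n^'n) \<times> (real^'n) \<Rightarrow> real"
    and T :: real
    and A :: "real \<Rightarrow> real^'n^'n"
    and \<Theta> :: "real \<Rightarrow> real^'n"
    and K :: "real \<Rightarrow> real^'n^'n"
    and g :: "real \<Rightarrow> real^'n"
  assumes "mesh \<D> C nbr"
    and "weight_on \<D> \<sigma>"
    and "\<Omega> = cell_volumes \<sigma> C"
    and "smooth_on (discrete_diffs \<Omega> \<times> UNIV) L"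
    and "T > 0"
    and "smooth_on {0..T} A"
    and "smooth_on {0..T} \<Theta>"
    and "\<forall>t\<in>{0..T}. A t \<in> sparse_diffs \<Omega> nbr"
    and "smooth_on {0..T} K"
    and "\<forall>t\<in>{0..T}. functional_derivatives \<Omega> L (A t) (\<Theta> t) (K t) (g t)"
  shows "critical \<Omega> nbr L T A \<Theta> \<longleftrightarrow>
    (\<exists>P :: real \<Rightarrow> real^'n. \<forall>t\<in>{0..T}. \<forall>i. \<forall>j\<in>nbr i.
       vector_derivative (\<lambda>s. K s $ i $ j) (at t within {0..T})
       + (commutator (K t ** \<Omega>) (A t) ** matrix_inv \<Omega>) $ i $ j
       - 1/2 * (g t $ i + g t $ j) * (\<Theta> t $ j - \<Theta> t $ i)
       + discrete_d (P t) $ i $ j = 0)"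
proof -
  have sym: "\<And>i j. j \<in> nbr i \<Longrightarrow> i \<in> nbr j"
    using assms(1) by (auto simp: mesh_def)
  interpret discrete_curve \<Omega> L T A \<Theta> K g
  proof
    show "pos_diagonal \<Omega>"
      unfolding assms(3) by (rule pos_diagonal_cell_volumes[OF assms(1,2)])
  qed (use assms in \<open>auto simp: sparse_diffs_def\<close>)
  have "critical \<Omega> nbr L T A \<Theta> \<longleftrightarrow>
    (\<exists>P. \<forall>t\<in>{0..T}. \<forall>i. \<forall>j\<in>nbr i. EL t $ i $ j + discrete_d (P t) $ i $ j = 0)"
    using sym by (rule critical_iff_gradient)
  then show ?thesis
    by (simp only: EL_nth cong: ball_cong)
qed

end
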